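(* Let $k\ge 4$ be an integer such that $p:=2^{k-1}-1$ is prime. Let $H$ be an arbitrary finite additive group, let $G:=(\mathbb{Z}/p\mathbb{Z})\times H$, and let $A:=A_0\times H$ where $A_0:=\{2^i \bmod p : i=0,\dots,k-2\}$. Then $\phi(A)=k-1$ and $|A|=(k-1)|H|$, but there do not exist $a_1,a_2\in A$ with $a_1+a_2=0$.
   Context: An additive group is an abelian group written with operation $+$. For subsets $A,B$ of an additive group $G$, $B$ is sum-avoiding in $A$ if there do not exist distinct $b_1,b_2\in B$ with $b_1+b_2\in A$. Define $\phi(A):=\sup\{|B| : B\subseteq A,\ B \text{ finite and sum-avoiding in } A\}$. *)

theory Defs
  imports
    "HOL-Algebra.Elementary_Groups"
    "HOL-Computational_Algebra.Primes"
    "HOL-Library.Extended_Nat"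
begin

(* An additive group is a commutative group in the sense of HOL-Algebra, so the
   group written G with operation + and neutral element 0 in additive notation
   appears with operation \<otimes>\<^bsub>G\<^esub> and neutral element \<one>\<^bsub>G\<^esub>. *)

definition sum_avoiding :: "('a, 'b) monoid_scheme \<Rightarrow> 'a set \<Rightarrow> 'a set \<Rightarrow> bool" where
  "sum_avoiding G A B \<longleftrightarrow>
     \<not> (\<exists>b\<^sub>1\<in>B. \<exists>b\<^sub>2\<in>B. b\<^sub>1 \<noteq> b\<^sub>2 \<and> b\<^sub>1 \<otimes>\<^bsub>G\<^esub> b\<^sub>2 \<in> A)"

(* The supremum is taken in the extended naturals, since it may be infinite when A is. *)
definition phi :: "('a, 'b) monoid_scheme \<Rightarrow> 'a set \<Rightarrow> enat" where
  "phi G A = Sup {enat (card B) | B. B \<subseteq> A \<and> finite B \<and> sum_avoiding G A B}"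

end

theory Submission
  imports Defs
begin

text \<open>
  Write \<open>n = k - 1\<close>, so that \<open>p = 2 ^ n - 1\<close> and \<open>2 ^ n\<close> is \<open>1\<close> modulo \<open>p\<close>. Two properties of
  the powers of two modulo \<open>p\<close> carry the proof. Doubling permutes them cyclically
  (\<open>double_power_of_two_mod\<close>). The sum of two different ones stays below \<open>p\<close>, so no reduction
  takes place, and it is not a power of two because it lies strictly between two consecutive ones
  (\<open>sum_of_two_powers_below_mersenne\<close>, \<open>sum_of_two_powers_not_power\<close>).

  In \<open>A = A\<^sub>0 \<times> H\<close> the second coordinate imposes no condition on a sum. Closure of \<open>A\<^sub>0\<close> under
  doubling therefore forbids a sum-avoiding set to meet a fibre \<open>{x} \<times> H\<close> twice, while one point
  in every fibre is sum-avoiding, since sums of different elements of \<open>A\<^sub>0\<close> leave \<open>A\<^sub>0\<close>. So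
  \<open>\<phi>(A) = \<bar>A\<^sub>0\<bar>\<close> (\<open>phi_product_with_monoid\<close>), however large \<open>H\<close> is. Both kinds of sums are
  nonzero modulo \<open>p\<close>, which rules out \<open>a\<^sub>1 + a\<^sub>2 = 0\<close>.
\<close>

text \<open>
  Two points in the same fibre over \<open>x\<close> have a product lying over \<open>x \<otimes> x \<in> S\<close>, hence inside
  \<open>S \<times> carrier H\<close>. So a sum-avoiding set projects injectively to \<open>S\<close>; conversely the
  section \<open>S \<times> {\<one>}\<close> is sum-avoiding and attains the bound.
\<close>

lemma phi_product_with_monoid:
  assumes H: "monoid H"
    and fin: "finite S"
    and double: "\<And>x. x \<in> S \<Longrightarrow> x \<otimes>\<^bsub>K\<^esub> x \<in> S"
    and distinct: "\<And>x y. x \<in> S \<Longrightarrow> y \<in> S \<Longrightarrow> x \<noteq> y \<Longrightarrow> x \<otimes>\<^bsub>K\<^esub> y \<notin> S"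
  shows "phi (K \<times>\<times> H) (S \<times> carrier H) = enat (card S)"
  unfolding phi_def
proof (rule Sup_eqI)
  interpret H: monoid H by (rule H)
  fix c
  assume "c \<in> {enat (card B) |B. B \<subseteq> S \<times> carrier H \<and> finite B
                 \<and> sum_avoiding (K \<times>\<times> H) (S \<times> carrier H) B}"
  then obtain B where c: "c = enat (card B)" and B: "B \<subseteq> S \<times> carrier H"
    and avoid: "sum_avoiding (K \<times>\<times> H) (S \<times> carrier H) B"
    by blast
  have "inj_on fst B"
  proof (rule inj_onI, rule ccontr)
    fix a b
    assume ab: "a \<in> B" "b \<in> B" and same: "fst a = fst b" and ne: "a \<noteq> b"
    obtain x g h where "a = (x, g)" "b = (x, h)"
      using same by (metis prod.collapse)
    with ab B double have "a \<otimes>\<^bsub>K \<times>\<times> H\<^esub> b \<in> S \<times> carrier H"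
      by auto
    moreover have "a \<otimes>\<^bsub>K \<times>\<times> H\<^esub> b \<notin> S \<times> carrier H"
      using avoid ab ne unfolding sum_avoiding_def by metis
    ultimately show False
      by contradiction
  qed
  moreover have "fst ` B \<subseteq> S"
    using B by auto
  ultimately show "c \<le> enat (card S)"
    using c fin by (simp add: card_inj_on_le)
next
  interpret H: monoid H by (rule H)
  fix u
  assume upper: "\<And>c. c \<in> {enat (card B) |B. B \<subseteq> S \<times> carrier H \<and> finite B
                        \<and> sum_avoiding (K \<times>\<times> H) (S \<times> carrier H) B} \<Longrightarrow> c \<le> u"
  have "sum_avoiding (K \<times>\<times> H) (S \<times> carrier H) (S \<times> {\<one>\<^bsub>H\<^esub>})"
    using distinct by (auto simp: sum_avoiding_def)
  moreover have "S \<times> {\<one>\<^bsub>H\<^esub>} \<subseteq> S \<times> carrier H"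
    by auto
  ultimately have "enat (card (S \<times> {\<one>\<^bsub>H\<^esub>})) \<le> u"
    using fin by (intro upper) blast
  then show "enat (card S) \<le> u"
    by (simp add: card_cartesian_product)
qed

text \<open>For \<open>i < j\<close> the sum lies strictly between \<open>2 ^ j\<close> and \<open>2 ^ Suc j\<close>.\<close>

lemma sum_of_two_powers_not_power:
  assumes "i \<noteq> j"
  shows "(2::int) ^ i + 2 ^ j \<noteq> 2 ^ m"
  using assms
proof (induction i j rule: linorder_wlog)
  case (le i j)
  show ?case
  proof
    assume eq: "(2::int) ^ i + 2 ^ j = 2 ^ m"
    have "(2::int) ^ i < 2 ^ j"
      using le by simp
    with eq have "(2::int) ^ m < 2 ^ Suc j"
      unfolding power_Suc by linarith
    moreover have "(2::int) ^ j < 2 ^ m"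
      unfolding eq[symmetric] by simp
    ultimately have "m < Suc j" "j < m"
      by (simp_all del: power_Suc)
    then show False
      by simp
  qed
next
  case (sym i j)
  then show ?case
    by (simp add: add.commute)
qed

text \<open>
  The largest such sum is \<open>2 ^ (n - 1) + 2 ^ (n - 2) = 2 ^ n - 2 ^ (n - 2)\<close>, which is below
  \<open>2 ^ n - 1\<close> exactly when \<open>n \<ge> 3\<close>; for \<open>n = 2\<close> it vanishes modulo \<open>3\<close>.
\<close>

lemma sum_of_two_powers_below_mersenne:
  assumes "n \<ge> 3" "i < n" "j < n" "i \<noteq> j"
  shows "(2::int) ^ i + 2 ^ j < 2 ^ n - 1"
  using assms(4,2,3)
proof (induction i j rule: linorder_wlog)
  case (le i j)
  obtain d where n: "n = Suc (Suc (Suc d))"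
    using \<open>n \<ge> 3\<close> by (metis Suc_le_D Suc_le_mono numeral_3_eq_3)
  have "(2::int) ^ i \<le> 2 ^ Suc d" "(2::int) ^ j \<le> 2 ^ Suc (Suc d)"
    using le n by (intro power_increasing; simp)+
  moreover have "(1::int) \<le> 2 ^ d"
    by simp
  ultimately show ?case
    unfolding n power_Suc by linarith
next
  case (sym i j)
  then show ?case
    by (simp add: add.commute)
qed

lemma power_of_two_below_mersenne:
  assumes "n \<ge> 2" "i < n"
  shows "(2::int) ^ i < 2 ^ n - 1"
proof -
  obtain d where n: "n = Suc (Suc d)"
    using \<open>n \<ge> 2\<close> by (metis Suc_le_D Suc_le_mono numeral_2_eq_2)
  have "(2::int) ^ i \<le> 2 ^ Suc d"
    using assms n by (intro power_increasing; simp)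
  moreover have "(1::int) \<le> 2 ^ d"
    by simp
  ultimately show ?thesis
    unfolding n power_Suc by linarith
qed

text \<open>The only wrap-around is at \<open>i = n - 1\<close>, where \<open>2 ^ n = (2 ^ n - 1) + 1\<close>.\<close>

lemma double_power_of_two_mod:
  assumes "n \<ge> 2" "i < n"
  shows "((2::int) ^ i + 2 ^ i) mod (2 ^ n - 1) = 2 ^ (Suc i mod n)"
proof (cases "Suc i = n")
  case True
  have one: "(1::int) < 2 ^ n - 1"
    using power_of_two_below_mersenne[of n 0] assms by simp
  have "(2::int) ^ i + 2 ^ i = 1 + (2 ^ n - 1)"
    by (simp flip: True)
  then have "((2::int) ^ i + 2 ^ i) mod (2 ^ n - 1) = 1 mod (2 ^ n - 1)"
    by (metis mod_add_self2)
  with one True show ?thesis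
    by simp
next
  case False
  then have "(2::int) ^ Suc i < 2 ^ n - 1"
    using assms by (intro power_of_two_below_mersenne) auto
  then show ?thesis
    using False assms by simp
qed

theorem proposition1p4:
  fixes k p :: nat
    and H :: "('h, 'm) monoid_scheme"
    and G :: "(int \<times> 'h) monoid"
    and A\<^sub>0 :: "int set"
    and A :: "(int \<times> 'h) set"
  assumes "k \<ge> 4"
    and "p = 2 ^ (k - 1) - 1"
    and "prime p"
    and "comm_group H"
    and "finite (carrier H)"
    and "G = integer_mod_group p \<times>\<times> H"
    and "A\<^sub>0 = {2 ^ i mod int p | i::nat. i \<in> {0..k - 2}}"
    and "A = A\<^sub>0 \<times> carrier H"
  shows "phi G A = enat (k - 1)
       \<and> card A = (k - 1) * card (carrier H)
       \<and> \<not> (\<exists>a\<^sub>1\<in>A. \<exists>a\<^sub>2\<in>A. a\<^sub>1 \<otimes>\<^bsub>G\<^esub> a\<^sub>2 = \<one>\<^bsub>G\<^esub>)"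
proof -
  define n where "n = k - 1"
  have n: "n \<ge> 3"
    using \<open>k \<ge> 4\<close> by (simp add: n_def)
  have p: "int p = 2 ^ n - 1"
    using assms(2) by (simp add: n_def of_nat_diff)
  have A0: "A\<^sub>0 = (\<lambda>i. 2 ^ i) ` {..<n}"
  proof -
    have "A\<^sub>0 = (\<lambda>i. 2 ^ i mod int p) ` {..<n}"
      unfolding assms(7) using \<open>k \<ge> 4\<close> by (auto simp: n_def)
    also have "\<dots> = (\<lambda>i. 2 ^ i) ` {..<n}"
      using power_of_two_below_mersenne[of n] n by (intro image_cong) (auto simp: p)
    finally show ?thesis .
  qed
  have card_A0: "card A\<^sub>0 = n"
    unfolding A0 by (simp add: card_image inj_on_def)
  have double: "((2::int) ^ i + 2 ^ i) mod int p = 2 ^ (Suc i mod n)" if "i < n" for i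
    using double_power_of_two_mod n that by (simp add: p)
  have distinct: "((2::int) ^ i + 2 ^ j) mod int p = 2 ^ i + 2 ^ j"
    if "i < n" "j < n" "i \<noteq> j" for i j
    using sum_of_two_powers_below_mersenne[OF n that] by (simp add: p)
  have "phi G A = enat (card A\<^sub>0)"
    unfolding assms(6,8)
  proof (rule phi_product_with_monoid)
    show "monoid H"
      using \<open>comm_group H\<close> by (simp add: comm_group_def group.is_monoid)
    show "finite A\<^sub>0"
      by (simp add: A0)
    show "x \<otimes>\<^bsub>integer_mod_group p\<^esub> x \<in> A\<^sub>0" if "x \<in> A\<^sub>0" for x
    proof -
      obtain i where "x = 2 ^ i" "i < n"
        using \<open>x \<in> A\<^sub>0\<close> by (auto simp: A0)
      then have "x \<otimes>\<^bsub>integer_mod_group p\<^esub> x = 2 ^ (Suc i mod n)"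
        by (simp only: mult_integer_mod_group double)
      with n show ?thesis
        by (simp add: A0)
    qed
    show "x \<otimes>\<^bsub>integer_mod_group p\<^esub> y \<notin> A\<^sub>0" if "x \<in> A\<^sub>0" "y \<in> A\<^sub>0" "x \<noteq> y" for x y
    proof -
      obtain i j where "x = 2 ^ i" "i < n" "y = 2 ^ j" "j < n" "i \<noteq> j"
        using \<open>x \<in> A\<^sub>0\<close> \<open>y \<in> A\<^sub>0\<close> \<open>x \<noteq> y\<close> by (auto simp: A0)
      then show ?thesis
        using sum_of_two_powers_not_power[of i j] by (auto simp: A0 distinct)
    qed
  qed
  moreover have "card A = n * card (carrier H)"
    by (simp add: assms(8) card_cartesian_product card_A0)
  moreover have "(x + y) mod int p \<noteq> 0" if "x \<in> A\<^sub>0" "y \<in> A\<^sub>0" for x y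
  proof -
    obtain i j where ij: "x = 2 ^ i" "i < n" "y = 2 ^ j" "j < n"
      using \<open>x \<in> A\<^sub>0\<close> \<open>y \<in> A\<^sub>0\<close> by (auto simp: A0)
    have "(2::int) ^ i + 2 ^ j > 0"
      by (simp add: add_pos_pos)
    then show ?thesis
      using ij double[of i] distinct[of i j] by (cases "i = j") auto
  qed
  then have "\<not> (\<exists>a\<^sub>1\<in>A. \<exists>a\<^sub>2\<in>A. a\<^sub>1 \<otimes>\<^bsub>G\<^esub> a\<^sub>2 = \<one>\<^bsub>G\<^esub>)"
    by (auto simp: assms(6,8))
  ultimately show ?thesis
    by (simp add: card_A0 n_def)
qed

end
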